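(* Let $j\ge 1$ and let $\alpha,\beta\in\mathcal{S}_j$ be involutions. Let $T_\alpha$ be a set of patterns, each of which begins with the prefix $\alpha$, and let $T_\beta$ be the set of patterns obtained by replacing, in each pattern in $T_\alpha$, the prefix $\alpha$ with the prefix $\beta$. For a shape $\lambda$ and a set $T$ of patterns, let $\lambda_{sym}(T)$ be the number of symmetric full placements on $\lambda$ which avoid all of the patterns in $T$. If for every self-conjugate shape $\lambda$ we have $\lambda_{sym}(\{\alpha\})=\lambda_{sym}(\{\beta\})$, then for every self-conjugate shape $\mu$ $$\mu_{sym}(T_\alpha)=\mu_{sym}(T_\beta).$$
   Context: A shape is a Ferrers shape $\lambda=(\lambda_1\ge\lambda_2\ge\cdots\ge\lambda_k>0)$, coordinatized from the bottom left corner: box $(x,y)$ (column $x$ from the left, row $y$ from the bottom) belongs to $\lambda$ iff $1\le y\le k$ and $1\le x\le\lambda_y$. It is self-conjugate if $(x,y)\in\lambda$ iff $(y,x)\in\lambda$. A placement on $\lambda$ is an assignment of dots to some boxes of $\lambda$ such that no row or column contains more than one dot; it is full if each row and each column of $\lambda$ contains exactly one dot. A placement on a self-conjugate shape is symmetric if it has a dot in $(x,y)$ iff it has a dot in $(y,x)$. The pattern of a sequence of $m$ distinct numbers is its order-preserving relabelling by $1,\dots,m$. A pattern is a permutation $\sigma\in\mathcal{S}_m$ written in one-line notation. A placement on $\lambda$ contains $\sigma\in\mathcal{S}_m$ if there are $m$ dots $(x_1,y_1),\dots,(x_m,y_m)$ in the placement with $x_1<\cdots<x_m$, with the pattern of $y_1\ldots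 y_m$ equal to $\sigma$, and all lying in a rectangular subshape of $\lambda$ (i.e. the box $(\max_i x_i,\max_i y_i)$ lies in $\lambda$). Otherwise it avoids $\sigma$. For $\alpha\in\mathcal{S}_j$, a pattern begins with the prefix $\alpha$ if it is of the form $\alpha\tau=\alpha_1\ldots\alpha_j\tau_{j+1}\ldots\tau_k$ with $k\ge j$ and $\tau=\tau_{j+1}\ldots\tau_k$ an ordering of $\{j+1,\dots,k\}$; replacing the prefix $\alpha$ by $\beta\in\mathcal{S}_j$ turns $\alpha\tau$ into $\beta\tau$. *)

theory Defs
  imports "HOL-Combinatorics.Multiset_Permutations"
begin

text \<open>
  A shape is the list of its row lengths, bottom row first. Boxes are 1-based pairs (column, row).
  The empty list (the empty shape) is admitted.
\<close>

definition is_shape :: "nat list \<Rightarrow> bool" where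
  "is_shape l \<longleftrightarrow> sorted_wrt (\<ge>) l \<and> (\<forall>r\<in>set l. 0 < r)"

definition boxes :: "nat list \<Rightarrow> (nat \<times> nat) set" where
  "boxes l = {(x, y). 1 \<le> y \<and> y \<le> length l \<and> 1 \<le> x \<and> x \<le> l ! (y - 1)}"

definition self_conjugate :: "nat list \<Rightarrow> bool" where
  "self_conjugate l \<longleftrightarrow> (\<forall>x y. (x, y) \<in> boxes l \<longleftrightarrow> (y, x) \<in> boxes l)"

text \<open>A placement is identified with its set of dots.\<close>

definition placement :: "nat list \<Rightarrow> (nat \<times> nat) set \<Rightarrow> bool" where
  "placement l P \<longleftrightarrow> P \<subseteq> boxes l \<and>
     (\<forall>x. \<exists>\<^sub>\<le>\<^sub>1 y. (x, y) \<in> P) \<and> (\<forall>y. \<exists>\<^sub>\<le>\<^sub>1 x. (x, y) \<in> P)"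

definition full_placement :: "nat list \<Rightarrow> (nat \<times> nat) set \<Rightarrow> bool" where
  "full_placement l P \<longleftrightarrow> placement l P \<and>
     (\<forall>x \<in> fst ` boxes l. \<exists>!y. (x, y) \<in> P) \<and> (\<forall>y \<in> snd ` boxes l. \<exists>!x. (x, y) \<in> P)"

definition symmetric_placement :: "(nat \<times> nat) set \<Rightarrow> bool" where
  "symmetric_placement P \<longleftrightarrow> (\<forall>x y. (x, y) \<in> P \<longleftrightarrow> (y, x) \<in> P)"

text \<open>
  A permutation in S_m in one-line notation is an element of
  \<^term>\<open>permutations_of_set {1..m::nat}\<close>, i.e. a duplicate-free list with entries exactly 1, ..., m.
  The identity counts as an involution.
\<close>

definition is_involution :: "nat list \<Rightarrow> bool" where
  "is_involution s \<longleftrightarrow> (\<forall>i\<in>{1..length s}. s ! (s ! (i - 1) - 1) = i)"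

text \<open>
  The order-preserving relabelling by 1, ..., m replaces each entry by its rank; see
  \<open>pattern_of_permutation\<close> and \<open>pattern_of_less_iff\<close> below.
\<close>

definition pattern_of :: "nat list \<Rightarrow> nat list" where
  "pattern_of ys = map (\<lambda>y. card {z \<in> set ys. z \<le> y}) ys"

text \<open>
  The last conjunct is meaningful only for nonempty patterns, since \<^term>\<open>Max {} :: nat\<close> is
  unspecified.
\<close>

definition contains_pattern :: "nat list \<Rightarrow> (nat \<times> nat) set \<Rightarrow> nat list \<Rightarrow> bool" where
  "contains_pattern l P s \<longleftrightarrow>
     (\<exists>ds. length ds = length s \<and> set ds \<subseteq> P \<and>
        sorted_wrt (<) (map fst ds) \<and> pattern_of (map snd ds) = s \<and>
        (Max (fst ` set ds), Max (snd ` set ds)) \<in> boxes l)"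

definition sym_count :: "nat list \<Rightarrow> nat list set \<Rightarrow> nat" where
  "sym_count l T = card {P. full_placement l P \<and> symmetric_placement P \<and>
     (\<forall>s\<in>T. \<not> contains_pattern l P s)}"

definition begins_with_prefix :: "nat list \<Rightarrow> nat list \<Rightarrow> bool" where
  "begins_with_prefix a s \<longleftrightarrow>
     (\<exists>k \<ge> length a. \<exists>t \<in> permutations_of_set {length a + 1..k}. s = a @ t)"

definition replace_prefix :: "nat list \<Rightarrow> nat list \<Rightarrow> nat list \<Rightarrow> nat list" where
  "replace_prefix a b s = b @ drop (length a) s"

lemma replace_prefix_append [simp]: "replace_prefix a b (a @ t) = b @ t"
  by (simp add: replace_prefix_def)

lemma finite_boxes: "finite (boxes l)"
proof -
  have "boxes l \<subseteq> {1..Max (set l)} \<times> {1..length l}"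
  proof
    fix p assume "p \<in> boxes l"
    then obtain x y where p: "p = (x, y)" "1 \<le> y" "y \<le> length l" "1 \<le> x" "x \<le> l ! (y - 1)"
      by (auto simp: boxes_def)
    then have "l ! (y - 1) \<in> set l" by simp
    then have "l ! (y - 1) \<le> Max (set l)" by simp
    with p(5) have "x \<le> Max (set l)" by (rule le_trans)
    with p(1-4) show "p \<in> {1..Max (set l)} \<times> {1..length l}" by simp
  qed
  then show ?thesis by (rule finite_subset) simp
qed

text \<open>The set counted by \<^const>\<open>sym_count\<close> is finite, so its cardinality is the true count.\<close>

lemma finite_sym_count:
  "finite {P. full_placement l P \<and> symmetric_placement P \<and> (\<forall>s\<in>T. \<not> contains_pattern l P s)}"
  by (rule finite_subset[of _ "Pow (boxes l)"])
     (auto simp: full_placement_def placement_def finite_boxes)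

lemma rank_less_iff:
  fixes A :: "nat set"
  assumes "finite A" "x \<in> A" "y \<in> A"
  shows "card {z \<in> A. z \<le> x} < card {z \<in> A. z \<le> y} \<longleftrightarrow> x < y"
proof
  assume "x < y"
  with assms have "{z \<in> A. z \<le> x} \<subset> {z \<in> A. z \<le> y}" by force
  with assms show "card {z \<in> A. z \<le> x} < card {z \<in> A. z \<le> y}"
    by (intro psubset_card_mono) auto
next
  assume less: "card {z \<in> A. z \<le> x} < card {z \<in> A. z \<le> y}"
  show "x < y"
  proof (rule ccontr)
    assume "\<not> x < y"
    then have "{z \<in> A. z \<le> y} \<subseteq> {z \<in> A. z \<le> x}" by auto
    with assms have "card {z \<in> A. z \<le> y} \<le> card {z \<in> A. z \<le> x}"
      by (intro card_mono) auto
    with less show False by simp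
  qed
qed

lemma pattern_of_less_iff:
  assumes "i < length ys" "k < length ys"
  shows "pattern_of ys ! i < pattern_of ys ! k \<longleftrightarrow> ys ! i < ys ! k"
  using assms by (simp add: pattern_of_def rank_less_iff)

lemma pattern_of_permutation:
  assumes "distinct ys"
  shows "pattern_of ys \<in> permutations_of_set {1..length ys}"
proof -
  let ?r = "\<lambda>y. card {z \<in> set ys. z \<le> y}"
  have inj: "inj_on ?r (set ys)"
  proof (rule inj_onI)
    fix x y assume "x \<in> set ys" "y \<in> set ys" "?r x = ?r y"
    then show "x = y"
      using rank_less_iff[of "set ys" x y] rank_less_iff[of "set ys" y x] by simp
  qed
  have "?r ` set ys \<subseteq> {1..length ys}"
  proof
    fix r assume "r \<in> ?r ` set ys"
    then obtain y where y: "y \<in> set ys" "r = ?r y" by auto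
    have "?r y \<le> card (set ys)" by (intro card_mono) auto
    moreover have "0 < ?r y" using y(1) by (auto simp: card_gt_0_iff)
    ultimately show "r \<in> {1..length ys}"
      using y(2) card_length[of ys] by (simp del: card_gt_0_iff add: Suc_le_eq)
  qed
  moreover have "card (?r ` set ys) = length ys"
    using inj assms by (simp add: card_image distinct_card)
  ultimately have "?r ` set ys = {1..length ys}"
    by (intro card_subset_eq) auto
  then show ?thesis
    using inj assms by (intro permutations_of_setI) (auto simp: pattern_of_def distinct_map)
qed

end

theory Submission
  imports Defs "HOL-Library.Infinite_Set"
begin

text \<open>
  Mark a box of the shape if the dots strictly above and to the right of it realise, up to
  reflection in the diagonal, one of the suffixes \<open>\<tau>\<close> inside the shape. For a symmetric placement the
  marked region \<open>M\<close> is a self-conjugate subshape, and since \<open>\<alpha>\<close> is an involution, the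
  placement avoids all \<open>\<alpha>\<tau>\<close> iff its part in \<open>M\<close> avoids \<open>\<alpha>\<close>. A last marked box on a diagonal is
  witnessed by dots outside \<open>M\<close>, so \<open>M\<close> depends only on the dots outside \<open>M\<close>. Fix these dots and
  delete the rows and columns they occupy: the rest is an arbitrary symmetric full placement on a
  smaller self-conjugate shape, where the hypothesis on \<open>\<alpha>\<close> and \<open>\<beta>\<close> applies.
\<close>

section \<open>Shapes as down-closed sets of boxes\<close>

text \<open>Regions are handled as sets of boxes because the marked region and its compression do
  not come as lists of row lengths. Positivity is included since boxes are 1-based.\<close>

definition down_closed :: "(nat \<times> nat) set \<Rightarrow> bool" where
  "down_closed B \<longleftrightarrow> (\<forall>(x, y) \<in> B. 1 \<le> x \<and> 1 \<le> y \<and>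
     (\<forall>x' y'. 1 \<le> x' \<and> x' \<le> x \<and> 1 \<le> y' \<and> y' \<le> y \<longrightarrow> (x', y') \<in> B))"

lemma down_closedD:
  "down_closed B \<Longrightarrow> (x, y) \<in> B \<Longrightarrow> 1 \<le> x' \<Longrightarrow> x' \<le> x \<Longrightarrow> 1 \<le> y' \<Longrightarrow> y' \<le> y \<Longrightarrow> (x', y') \<in> B"
  unfolding down_closed_def by blast

lemma down_closed_pos: "down_closed B \<Longrightarrow> (x, y) \<in> B \<Longrightarrow> 1 \<le> x \<and> 1 \<le> y"
  unfolding down_closed_def by blast

lemma down_closed_boxes:
  assumes "is_shape l"
  shows "down_closed (boxes l)"
proof -
  have "l ! (y - 1) \<le> l ! (y' - 1)" if "1 \<le> y'" "y' \<le> y" "y \<le> length l" for y y'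
  proof (cases "y' = y")
    case False
    with that have "y' - 1 < y - 1" "y - 1 < length l" by auto
    with assms show ?thesis by (simp add: is_shape_def sorted_wrt_iff_nth_less)
  qed simp
  then show ?thesis
    unfolding down_closed_def boxes_def by (auto intro: order_trans)
qed

lemma initial_segment:
  fixes A :: "nat set"
  assumes "finite A" "\<And>x. x \<in> A \<Longrightarrow> 1 \<le> x" "\<And>x x'. x \<in> A \<Longrightarrow> 1 \<le> x' \<Longrightarrow> x' \<le> x \<Longrightarrow> x' \<in> A"
  shows "A = {1..card A}"
proof (cases "A = {}")
  case False
  have "A = {1..Max A}"
  proof
    show "A \<subseteq> {1..Max A}" using assms(1,2) by auto
    show "{1..Max A} \<subseteq> A" using assms(3)[OF Max_in[OF assms(1) False]] by auto
  qed
  then obtain b where "A = {1..b}" by blast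
  then show ?thesis by simp
qed simp

text \<open>Needed to apply the hypothesis, which speaks of lists of row lengths, to a region built
  as a set. Every row and the first column are initial segments, so their sizes determine the
  list.\<close>

lemma ex_shape_boxes:
  assumes "finite B" "down_closed B"
  obtains l where "is_shape l" "boxes l = B"
proof -
  define row where "row y = {x. (x, y) \<in> B}" for y
  define col where "col = {y. (1, y) \<in> B}"
  have fr: "finite (row y)" for y
    by (rule finite_subset[of _ "fst ` B"]) (auto simp: row_def image_iff assms, force)
  have fc: "finite col"
    by (rule finite_subset[of _ "snd ` B"]) (auto simp: col_def image_iff assms, force)
  have row: "row y = {1..card (row y)}" for y
  proof (rule initial_segment[OF fr])
    fix x assume "x \<in> row y"
    then have x: "(x, y) \<in> B" by (simp add: row_def)
    from down_closed_pos[OF assms(2) x] show "1 \<le> x" by blast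
    fix x' assume "1 \<le> x'" "x' \<le> x"
    with down_closed_pos[OF assms(2) x] down_closedD[OF assms(2) x] show "x' \<in> row y"
      by (simp add: row_def)
  qed
  have col: "col = {1..card col}"
  proof (rule initial_segment[OF fc])
    fix y assume "y \<in> col"
    then have y: "(1, y) \<in> B" by (simp add: col_def)
    from down_closed_pos[OF assms(2) y] show "1 \<le> y" by blast
    fix y' assume "1 \<le> y'" "y' \<le> y"
    with down_closedD[OF assms(2) y] show "y' \<in> col" by (simp add: col_def)
  qed
  define l where "l = map (\<lambda>i. card (row (Suc i))) [0..<card col]"
  have mem: "(x, y) \<in> B \<longleftrightarrow> y \<in> {1..card col} \<and> x \<in> {1..card (row y)}" for x y
  proof -
    have "(x, y) \<in> B \<longleftrightarrow> y \<in> col \<and> x \<in> row y"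
      using down_closed_pos[OF assms(2), of x y] down_closedD[OF assms(2), of x y 1 y]
      by (auto simp: row_def col_def)
    then show ?thesis using row[of y] col by blast
  qed
  have "boxes l = B"
  proof -
    have "(x, y) \<in> boxes l \<longleftrightarrow> (x, y) \<in> B" for x y
      unfolding mem boxes_def l_def by (cases y) auto
    then show ?thesis by auto
  qed
  moreover have "is_shape l"
  proof -
    have "card (row (Suc k)) \<le> card (row (Suc i))" if "i < k" for i k
    proof (rule card_mono[OF fr], rule subsetI)
      fix x assume "x \<in> row (Suc k)"
      then have x: "(x, Suc k) \<in> B" by (simp add: row_def)
      show "x \<in> row (Suc i)"
        using down_closed_pos[OF assms(2) x] down_closedD[OF assms(2) x] that by (simp add: row_def)
    qed
    moreover have "0 < card (row (Suc i))" if "i < card col" for i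
    proof -
      have "Suc i \<in> col" using that by (subst col) simp
      then have "1 \<in> row (Suc i)" by (simp add: row_def col_def)
      then show ?thesis using fr card_gt_0_iff by blast
    qed
    ultimately show ?thesis
      by (auto simp: is_shape_def l_def sorted_wrt_iff_nth_less)
  qed
  ultimately show thesis using that by blast
qed

section \<open>Occurrences of patterns\<close>

text \<open>The dots of an occurrence are \<open>(X i, Y (s\<^sub>i))\<close>, where \<open>X\<close> and \<open>Y\<close> list the occupied
  columns and rows in increasing order; inverting the pattern then amounts to exchanging
  \<open>X\<close> and \<open>Y\<close>.\<close>

definition occurs :: "(nat \<times> nat) set \<Rightarrow> (nat \<times> nat) set \<Rightarrow> nat list \<Rightarrow> bool" where
  "occurs B P s \<longleftrightarrow> (\<exists>X Y. strict_mono_on {1..length s} X \<and> strict_mono_on {1..length s} Y \<and>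
     (\<forall>i \<in> {1..length s}. (X i, Y (s ! (i - 1))) \<in> P) \<and> (X (length s), Y (length s)) \<in> B)"

lemma permutation_nth_mem:
  assumes "s \<in> permutations_of_set {1..m::nat}" "i \<in> {1..m}"
  shows "s ! (i - 1) \<in> {1..m}"
proof -
  have "length s = m" using assms(1) length_finite_permutations_of_set by fastforce
  then have "s ! (i - 1) \<in> set s" using assms(2) by auto
  then show ?thesis using assms(1) by (simp add: permutations_of_set_def)
qed

lemma permutation_nth_surj:
  assumes "s \<in> permutations_of_set {1..m::nat}" "v \<in> {1..m}"
  obtains i where "i \<in> {1..m}" "s ! (i - 1) = v"
proof -
  have len: "length s = m" using assms(1) length_finite_permutations_of_set by fastforce
  have "v \<in> set s" using assms by (simp add: permutations_of_set_def)
  then obtain i where "i < m" "s ! i = v" using len by (auto simp: in_set_conv_nth)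
  then show thesis using that[of "Suc i"] by auto
qed

lemma mono_on_le: "strict_mono_on A (f :: nat \<Rightarrow> nat) \<Longrightarrow> i \<in> A \<Longrightarrow> k \<in> A \<Longrightarrow> i \<le> k \<Longrightarrow> f i \<le> f k"
  by (metis strict_mono_on_leD)

lemma Max_image_mono_on:
  assumes "strict_mono_on {1..m} (f :: nat \<Rightarrow> nat)" "1 \<le> m"
  shows "Max (f ` {1..m}) = f m"
  using assms by (intro Max_eqI) (auto intro: mono_on_le)

text \<open>Listing the dots by column yields \<open>X\<close>, inverting the ranking of their
  heights yields \<open>Y\<close>, and by monotonicity the corner of maxima is
  \<open>(X m, Y m)\<close>. The bound on \<open>m\<close> keeps these maxima over nonempty
  sets.\<close>

lemma contains_pattern_iff_occurs:
  assumes s: "s \<in> permutations_of_set {1..m}" and m: "1 \<le> m"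
  shows "contains_pattern l P s \<longleftrightarrow> occurs (boxes l) P s"
proof -
  have len: "length s = m" using s length_finite_permutations_of_set by fastforce
  have set_s: "set s = {1..m}" and dist_s: "distinct s" using s by (auto simp: permutations_of_set_def)
  show ?thesis
  proof
    assume "contains_pattern l P s"
    then obtain ds where ds: "length ds = m" "set ds \<subseteq> P" "sorted_wrt (<) (map fst ds)"
      "pattern_of (map snd ds) = s" "(Max (fst ` set ds), Max (snd ` set ds)) \<in> boxes l"
      unfolding contains_pattern_def len by blast
    define ys where "ys = map snd ds"
    define r where "r y = card {z \<in> set ys. z \<le> y}" for y
    define X where "X i = fst (ds ! (i - 1))" for i
    \<comment> \<open>\<open>r\<close> sends a height to its rank, so its inverse lists the occupied
      rows in increasing order.\<close>
    define Y where "Y = inv_into (set ys) r"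
    have s_eq: "s = map r ys" using ds(4) unfolding pattern_of_def r_def ys_def by simp
    have r_less: "r x < r y \<longleftrightarrow> x < y" if "x \<in> set ys" "y \<in> set ys" for x y
      unfolding r_def using that by (intro rank_less_iff) auto
    have inj: "inj_on r (set ys)"
      by (rule inj_onI) (metis r_less less_irrefl linorder_neqE_nat)
    have im: "r ` set ys = {1..m}" using s_eq set_s by (metis set_map)
    have Y_mem: "Y v \<in> set ys" "r (Y v) = v" if "v \<in> {1..m}" for v
      using that im unfolding Y_def by (auto intro: inv_into_into f_inv_into_f)
    have Y: "strict_mono_on {1..m} Y"
      by (rule strict_mono_onI) (metis Y_mem r_less)
    have X: "strict_mono_on {1..m} X"
      using ds(1,3) by (intro strict_mono_onI) (auto simp: X_def sorted_wrt_iff_nth_less)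
    have dots: "(X i, Y (s ! (i - 1))) = ds ! (i - 1)" if "i \<in> {1..m}" for i
    proof -
      have "i - 1 < length ys" using that ds(1) by (auto simp: ys_def)
      then have "Y (s ! (i - 1)) = ys ! (i - 1)"
        unfolding s_eq Y_def using inj by simp
      then show ?thesis using that ds(1) by (auto simp: X_def ys_def)
    qed
    have P: "(X i, Y (s ! (i - 1))) \<in> P" if "i \<in> {1..m}" for i
    proof -
      have "ds ! (i - 1) \<in> set ds" using that ds(1) by auto
      then show ?thesis using dots[OF that] ds(2) by auto
    qed
    have "fst ` set ds = X ` {1..m}"
    proof -
      have "set ds = (\<lambda>i. ds ! (i - 1)) ` {1..m}"
        using ds(1) by (force simp: set_conv_nth image_iff)
      then show ?thesis by (simp add: X_def image_image)
    qed
    moreover have "snd ` set ds = Y ` {1..m}"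
    proof -
      have "Y ` {1..m} = set ys" unfolding Y_def im[symmetric] using inj by simp
      then show ?thesis by (simp add: ys_def)
    qed
    ultimately have "(X m, Y m) \<in> boxes l"
      using ds(5) Max_image_mono_on[OF X m] Max_image_mono_on[OF Y m] by simp
    then show "occurs (boxes l) P s" unfolding occurs_def len using X Y P by blast
  next
    assume "occurs (boxes l) P s"
    then obtain X Y where X: "strict_mono_on {1..m} X" and Y: "strict_mono_on {1..m} Y"
      and P: "\<And>i. i \<in> {1..m} \<Longrightarrow> (X i, Y (s ! (i - 1))) \<in> P" and B: "(X m, Y m) \<in> boxes l"
      unfolding occurs_def len by blast
    define ds where "ds = map (\<lambda>i. (X (Suc i), Y (s ! i))) [0..<m]"
    have "length ds = m" by (simp add: ds_def)
    moreover have "set ds \<subseteq> P" using P[of "Suc _"] by (auto simp: ds_def)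
    moreover have "sorted_wrt (<) (map fst ds)"
      using X by (auto simp: ds_def sorted_wrt_iff_nth_less strict_mono_on_def)
    moreover have snds: "map snd ds = map Y s"
      by (rule nth_equalityI) (auto simp: ds_def len)
    have "pattern_of (map snd ds) = s"
    proof -
      \<comment> \<open>The occupied heights up to \<open>Y v\<close> are exactly
        \<open>Y 1\<close>, ..., \<open>Y v\<close>, so the rank of \<open>Y v\<close> is
        \<open>v\<close>.\<close>
      have "card {z \<in> Y ` {1..m}. z \<le> Y v} = v" if v: "v \<in> {1..m}" for v
      proof -
        have "{z \<in> Y ` {1..m}. z \<le> Y v} = Y ` {1..v}"
        proof -
          have "u \<le> v" if "u \<in> {1..m}" "Y u \<le> Y v" for u
            using that v Y by (meson not_le strict_mono_onD)
          then show ?thesis using v Y by (auto intro: mono_on_le)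
        qed
        moreover have "inj_on Y {1..v}"
          using Y v by (meson atLeastatMost_subset_iff atLeastAtMost_iff order_refl inj_on_subset strict_mono_on_imp_inj_on)
        ultimately show ?thesis by (simp add: card_image)
      qed
      then show ?thesis unfolding snds pattern_of_def
        by (intro nth_equalityI) (use set_s len permutation_nth_mem[OF s, of "Suc _"] in auto)
    qed
    moreover have "fst ` set ds = X ` {1..m}"
    proof -
      have "{1..m} = Suc ` {0..<m}"
        by (simp add: image_Suc_atLeastLessThan atLeastLessThanSuc_atLeastAtMost)
      then show ?thesis
        by (simp only:) (simp add: ds_def image_image del: image_Suc_atLeastLessThan)
    qed
    moreover have "snd ` set ds = Y ` {1..m}"
      using snds set_s by (metis set_map)
    ultimately show "contains_pattern l P s"
      unfolding contains_pattern_def len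
      using B Max_image_mono_on[OF X m] Max_image_mono_on[OF Y m]
      by (intro exI[of _ ds]) simp
  qed
qed

section \<open>The marked region\<close>

text \<open>\<open>W\<close> is a family of dot configurations that can serve as witnesses. The
  empty configuration marks all of \<open>B\<close>, which is how a pattern with empty suffix fits
  in.\<close>

definition marked :: "(nat \<times> nat) set \<Rightarrow> (nat \<times> nat) set set \<Rightarrow> (nat \<times> nat) set \<Rightarrow> (nat \<times> nat) set" where
  "marked B W P = {(x, y) \<in> B. \<exists>F \<in> W. F \<subseteq> P \<and> (\<forall>(a, b) \<in> F. x < a \<and> y < b)}"

lemma marked_subset: "marked B W P \<subseteq> B"
  by (auto simp: marked_def)

lemma marked_mono: "P \<subseteq> P' \<Longrightarrow> marked B W P \<subseteq> marked B W P'"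
  unfolding marked_def by blast

lemma down_closed_marked:
  assumes "down_closed B"
  shows "down_closed (marked B W P)"
  unfolding down_closed_def
proof (intro ballI, clarify)
  fix x y assume "(x, y) \<in> marked B W P"
  then obtain F where F: "(x, y) \<in> B" "F \<in> W" "F \<subseteq> P" "\<forall>(a, b) \<in> F. x < a \<and> y < b"
    by (auto simp: marked_def)
  have "(x', y') \<in> marked B W P" if "1 \<le> x'" "x' \<le> x" "1 \<le> y'" "y' \<le> y" for x' y'
  proof -
    have "\<forall>(a, b) \<in> F. x' < a \<and> y' < b" using F(4) that by auto
    then show ?thesis
      unfolding marked_def using F(2,3) down_closedD[OF assms F(1) that] by blast
  qed
  then show "1 \<le> x \<and> 1 \<le> y \<and> (\<forall>x' y'. 1 \<le> x' \<and> x' \<le> x \<and> 1 \<le> y' \<and> y' \<le> y \<longrightarrow> (x', y') \<in> marked B W P)"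
    using down_closed_pos[OF assms F(1)] by blast
qed

lemma converse_marked:
  assumes "B\<inverse> = B" "converse ` W = W" "P\<inverse> = P"
  shows "(marked B W P)\<inverse> = marked B W P"
proof -
  have *: "(y, x) \<in> marked B W P" if "(x, y) \<in> marked B W P" for x y
  proof -
    from that obtain F where F: "(x, y) \<in> B" "F \<in> W" "F \<subseteq> P" "\<forall>(a, b) \<in> F. x < a \<and> y < b"
      by (auto simp: marked_def)
    have "(y, x) \<in> B" "F\<inverse> \<in> W" "F\<inverse> \<subseteq> P"
      using F assms by blast+
    moreover have "\<forall>(a, b) \<in> F\<inverse>. y < a \<and> x < b" using F(4) by auto
    ultimately show ?thesis unfolding marked_def by blast
  qed
  then show ?thesis by auto
qed

text \<open>Going from a marked box along the diagonal to the last marked one, the configuration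
  witnessing the latter contains no dot in a marked box.\<close>

lemma marked_remove_marked:
  assumes "finite B" "down_closed B"
  shows "marked B W (P - marked B W P) = marked B W P"
proof
  let ?M = "marked B W P"
  show "marked B W (P - ?M) \<subseteq> ?M" by (rule marked_mono) simp
  show "?M \<subseteq> marked B W (P - ?M)"
  proof clarify
    fix x y assume xy: "(x, y) \<in> ?M"
    define K where "K = {k. (x + k, y + k) \<in> ?M}"
    have "finite ?M" using assms(1) marked_subset by (rule finite_subset[rotated])
    then have "finite K"
      by (intro finite_imageD[of "\<lambda>k. (x + k, y + k)" K] inj_onI)
         (auto simp: K_def elim!: finite_subset[rotated])
    moreover have "0 \<in> K" using xy by (simp add: K_def)
    ultimately have k: "Max K \<in> K" and k_max: "Suc (Max K) \<notin> K"
      using Max_in Max_ge by (blast, metis Suc_n_not_le_n)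
    define k where "k = Max K"
    from k obtain F where F: "F \<in> W" "F \<subseteq> P" "\<And>a b. (a, b) \<in> F \<Longrightarrow> x + k < a \<and> y + k < b"
      unfolding K_def k_def marked_def by blast
    \<comment> \<open>A dot of \<open>F\<close> lies weakly above and to the right of the next
      diagonal box, so a marked dot would make that box marked, against the maximality of
      \<open>k\<close>.\<close>
    have "(a, b) \<notin> ?M" if "(a, b) \<in> F" for a b
    proof
      assume "(a, b) \<in> ?M"
      then have "(x + Suc k, y + Suc k) \<in> ?M"
        by (rule down_closedD[OF down_closed_marked[OF assms(2)]]) (use F(3)[OF that] in auto)
      then show False using k_max by (simp add: K_def k_def)
    qed
    then have "F \<subseteq> P - ?M" using F(2) by auto
    moreover have "(x, y) \<in> B" using xy by (simp add: marked_def)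
    moreover have "\<forall>(a, b) \<in> F. x < a \<and> y < b" using F(3) by fastforce
    ultimately show "(x, y) \<in> marked B W (P - ?M)" unfolding marked_def using F(1) by blast
  qed
qed

text \<open>Makes precise that the region is determined by the dots outside it. Extra dots only add
  marks, so \<open>M\<close> is contained in the region of \<open>P\<close>; hence the dots of
  \<open>P\<close> outside its region lie in \<open>P - M\<close>, and by
  \<open>marked_remove_marked\<close> they already produce the whole region.\<close>

lemma marked_eqI:
  assumes "finite B" "down_closed B" "marked B W (P - M) = M"
  shows "marked B W P = M"
proof
  show "M \<subseteq> marked B W P"
    using assms(3) marked_mono[of "P - M" P] by blast
  then have "P - marked B W P \<subseteq> P - M" by blast
  then show "marked B W P \<subseteq> M"
    using marked_remove_marked[OF assms(1,2)] marked_mono assms(3) by metis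
qed

section \<open>Configurations realising a suffix\<close>

text \<open>Indices start at \<open>Suc j\<close> so that \<open>X\<close> and \<open>Y\<close>
  continue the numbering used for a prefix of length \<open>j\<close>. The corner condition is
  waived for the empty suffix, where the index \<open>j\<close> would fall outside the range of the
  configuration.\<close>

definition suffix_configs :: "(nat \<times> nat) set \<Rightarrow> nat \<Rightarrow> nat list set \<Rightarrow> (nat \<times> nat) set set" where
  "suffix_configs B j S = {F. \<exists>t \<in> S. \<exists>X Y.
     strict_mono_on {Suc j..j + length t} X \<and> strict_mono_on {Suc j..j + length t} Y \<and>
     (t \<noteq> [] \<longrightarrow> (X (j + length t), Y (j + length t)) \<in> B) \<and>
     F = (\<lambda>i. (X i, Y (t ! (i - Suc j)))) ` {Suc j..j + length t}}"

text \<open>Adding the reflected configurations makes the marked region of a symmetric placement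
  symmetric, although the set of suffixes need not be closed under inversion.\<close>

definition sym_suffix_configs :: "(nat \<times> nat) set \<Rightarrow> nat \<Rightarrow> nat list set \<Rightarrow> (nat \<times> nat) set set" where
  "sym_suffix_configs B j S = suffix_configs B j S \<union> converse ` suffix_configs B j S"

lemma converse_sym_suffix_configs: "converse ` sym_suffix_configs B j S = sym_suffix_configs B j S"
  by (auto simp: sym_suffix_configs_def image_Un image_image)

lemma strict_mono_on_glue:
  fixes X X' :: "nat \<Rightarrow> nat"
  assumes "strict_mono_on {1..j} X" "strict_mono_on {Suc j..m} X'" "1 \<le> j"
    and "\<And>k. k \<in> {Suc j..m} \<Longrightarrow> X j < X' k"
  shows "strict_mono_on {1..m} (\<lambda>i. if i \<le> j then X i else X' i)"
proof (rule strict_mono_onI)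
  fix r s assume rs: "r \<in> {1..m}" "s \<in> {1..m}" "r < s"
  consider "s \<le> j" | "r \<le> j" "j < s" | "j < r" by linarith
  then show "(if r \<le> j then X r else X' r) < (if s \<le> j then X s else X' s)"
  proof cases
    case 1
    with rs assms(1) show ?thesis by (auto simp: strict_mono_on_def)
  next
    case 2
    have "X r \<le> X j" using 2 rs assms(3) by (intro mono_on_le[OF assms(1)]) auto
    also have "X j < X' s" using 2 rs by (intro assms(4)) auto
    finally show ?thesis using 2 by simp
  next
    case 3
    with rs assms(2) show ?thesis by (auto simp: strict_mono_on_def)
  qed
qed

section \<open>Occurrences of the prefix in the marked region\<close>

text \<open>The dots of the suffix all lie strictly above and to the right of the corner
  \<open>(X j, Y j)\<close> of the prefix part, so they mark this corner.\<close>

lemma occurs_append_imp_occurs_marked: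
  assumes a: "a \<in> permutations_of_set {1..j}" and j: "1 \<le> j"
    and t: "t \<in> permutations_of_set {j + 1..k}" "j \<le> k" "t \<in> S"
    and B: "down_closed B" and P: "P \<subseteq> B"
    and occ: "occurs B P (a @ t)"
  shows "occurs (marked B (sym_suffix_configs B j S) P) P a"
proof -
  have len_a: "length a = j" using a length_finite_permutations_of_set by fastforce
  have len_t: "length t = k - j" using t length_finite_permutations_of_set by fastforce
  have set_t: "set t = {j + 1..k}" using t by (auto simp: permutations_of_set_def)
  have len: "length (a @ t) = k" using len_a len_t t by simp
  from occ obtain X Y where X: "strict_mono_on {1..k} X" and Y: "strict_mono_on {1..k} Y"
    and dots: "\<And>i. i \<in> {1..k} \<Longrightarrow> (X i, Y ((a @ t) ! (i - 1))) \<in> P" and top: "(X k, Y k) \<in> B"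
    unfolding occurs_def len by blast
  have dots_a: "(X i, Y (a ! (i - 1))) \<in> P" if "i \<in> {1..j}" for i
    using dots[of i] that t(2) by (auto simp: nth_append len_a split: if_splits)
  have dots_t: "(X i, Y (t ! (i - Suc j))) \<in> P" if "i \<in> {Suc j..k}" for i
    using dots[of i] that by (auto simp: nth_append len_a split: if_splits)
  define F where "F = (\<lambda>i. (X i, Y (t ! (i - Suc j)))) ` {Suc j..k}"
  have sub: "strict_mono_on A X" "strict_mono_on A Y" if "A \<subseteq> {1..k}" for A
    using that X Y by (meson monotone_on_subset)+
  have "F \<in> suffix_configs B j S"
    unfolding suffix_configs_def F_def
    by (rule CollectI, rule bexI[OF _ t(3)], rule exI[of _ X], rule exI[of _ Y])
      (use t(2) sub[of "{Suc j..k}"] top in \<open>auto simp: len_t\<close>)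
  then have "F \<in> sym_suffix_configs B j S" by (simp add: sym_suffix_configs_def)
  moreover have "F \<subseteq> P" using dots_t by (auto simp: F_def)
  moreover have "\<forall>(u, v) \<in> F. X j < u \<and> Y j < v"
  proof -
    have "X j < X i \<and> Y j < Y (t ! (i - Suc j))" if "i \<in> {Suc j..k}" for i
    proof -
      have "t ! (i - Suc j) \<in> set t" using that len_t by auto
      then have "t ! (i - Suc j) \<in> {j + 1..k}" using set_t by simp
      then show ?thesis
        using that j strict_mono_onD[OF X, of j i] strict_mono_onD[OF Y, of j "t ! (i - Suc j)"] by simp
    qed
    then show ?thesis by (auto simp: F_def)
  qed
  \<comment> \<open>The corner need not carry a dot. Its column contains the dot with index
    \<open>j\<close> and its row the dot with entry \<open>j\<close>, so its coordinates are
    positive and it lies below and left of the top corner.\<close>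
  moreover have "(X j, Y j) \<in> B"
  proof -
    obtain i where i: "i \<in> {1..j}" "a ! (i - 1) = j"
      using permutation_nth_surj[OF a, of j] j by auto
    have "1 \<le> X j" using dots_a[of j] j P B by (auto dest!: down_closed_pos subsetD)
    moreover have "1 \<le> Y j" using dots_a[OF i(1)] i(2) P B by (auto dest!: down_closed_pos subsetD)
    moreover have "X j \<le> X k" "Y j \<le> Y k"
      using j t(2) by (auto intro!: mono_on_le[OF X] mono_on_le[OF Y])
    ultimately show ?thesis using down_closedD[OF B top] by blast
  qed
  ultimately have "(X j, Y j) \<in> marked B (sym_suffix_configs B j S) P"
    unfolding marked_def by blast
  then show ?thesis
    unfolding occurs_def len_a using sub[of "{1..j}"] t(2) dots_a
    by (intro exI[of _ X] exI[of _ Y]) auto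
qed

text \<open>A witness of the marked corner extends the occurrence of \<open>a\<close> to one of
  \<open>a @ t\<close>. If only the reflected witness realises a suffix, the whole picture is
  reflected first: the prefix part then realises the inverse of \<open>a\<close>, which is
  \<open>a\<close> itself.\<close>

lemma occurs_marked_imp_occurs_append:
  assumes a: "a \<in> permutations_of_set {1..j}" and j: "1 \<le> j" and inv: "is_involution a"
    and S: "\<And>t. t \<in> S \<Longrightarrow> \<exists>k\<ge>j. t \<in> permutations_of_set {j + 1..k}"
    and B: "B\<inverse> = B" and P: "P\<inverse> = P"
    and occ: "occurs (marked B (sym_suffix_configs B j S) P) P a"
  shows "\<exists>t \<in> S. occurs B P (a @ t)"
proof -
  have len_a: "length a = j" using a length_finite_permutations_of_set by fastforce
  from occ obtain X Y where X: "strict_mono_on {1..j} X" and Y: "strict_mono_on {1..j} Y"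
    and dots: "\<And>i. i \<in> {1..j} \<Longrightarrow> (X i, Y (a ! (i - 1))) \<in> P"
    and top: "(X j, Y j) \<in> marked B (sym_suffix_configs B j S) P"
    unfolding occurs_def len_a by blast
  from top obtain F where top_B: "(X j, Y j) \<in> B" and F: "F \<in> sym_suffix_configs B j S" "F \<subseteq> P"
    "\<forall>(u, v) \<in> F. X j < u \<and> Y j < v"
    unfolding marked_def by blast
  \<comment> \<open>Normalisation to an unreflected configuration.\<close>
  have "\<exists>X Y F. strict_mono_on {1..j} X \<and> strict_mono_on {1..j} Y \<and>
      (\<forall>i \<in> {1..j}. (X i, Y (a ! (i - 1))) \<in> P) \<and> (X j, Y j) \<in> B \<and>
      F \<in> suffix_configs B j S \<and> F \<subseteq> P \<and> (\<forall>(u, v) \<in> F. X j < u \<and> Y j < v)"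
  proof (cases "F \<in> suffix_configs B j S")
    case True
    then show ?thesis using X Y dots top_B F by blast
  next
    case False
    then obtain G where G: "G \<in> suffix_configs B j S" "F = G\<inverse>"
      using F(1) by (auto simp: sym_suffix_configs_def)
    have "(Y i, X (a ! (i - 1))) \<in> P" if i: "i \<in> {1..j}" for i
    proof -
      have "(X (a ! (i - 1)), Y (a ! (a ! (i - 1) - 1))) \<in> P"
        by (rule dots[OF permutation_nth_mem[OF a i]])
      moreover have "a ! (a ! (i - 1) - 1) = i"
        using inv i unfolding is_involution_def len_a by blast
      ultimately have "(X (a ! (i - 1)), Y i) \<in> P" by simp
      then show ?thesis using P by blast
    qed
    moreover have "(Y j, X j) \<in> B" using top_B B by blast
    moreover have "G \<subseteq> P" using F(2) unfolding G(2) by (metis P converse_mono)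
    moreover have "\<forall>(u, v) \<in> G. Y j < u \<and> X j < v" using F(3) G(2) by auto
    ultimately show ?thesis using X Y G(1) by blast
  qed
  then obtain X Y F where X: "strict_mono_on {1..j} X" and Y: "strict_mono_on {1..j} Y"
    and dots: "\<And>i. i \<in> {1..j} \<Longrightarrow> (X i, Y (a ! (i - 1))) \<in> P" and top: "(X j, Y j) \<in> B"
    and F: "F \<in> suffix_configs B j S" "F \<subseteq> P" "\<forall>(u, v) \<in> F. X j < u \<and> Y j < v"
    by blast
  from F(1) obtain t X' Y' where tS: "t \<in> S"
    and X': "strict_mono_on {Suc j..j + length t} X'"
    and Y': "strict_mono_on {Suc j..j + length t} Y'"
    and top': "t \<noteq> [] \<Longrightarrow> (X' (j + length t), Y' (j + length t)) \<in> B"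
    and F_eq: "F = (\<lambda>i. (X' i, Y' (t ! (i - Suc j)))) ` {Suc j..j + length t}"
    unfolding suffix_configs_def by blast
  from S[OF tS] obtain k where k: "j \<le> k" "t \<in> permutations_of_set {j + 1..k}" by blast
  have len_t: "length t = k - j" using k(2) length_finite_permutations_of_set by fastforce
  have jk: "j + length t = k" using k(1) len_t by simp
  note X' = X'[unfolded jk] and Y' = Y'[unfolded jk] and top' = top'[unfolded jk] and F_eq = F_eq[unfolded jk]
  have set_t: "set t = {j + 1..k}" using k(2) by (auto simp: permutations_of_set_def)
  have len: "length (a @ t) = k" using len_a jk by simp
  define X'' where "X'' i = (if i \<le> j then X i else X' i)" for i
  define Y'' where "Y'' i = (if i \<le> j then Y i else Y' i)" for i
  have NE: "X j < X' i" "Y j < Y' (t ! (i - Suc j))" if "i \<in> {Suc j..k}" for i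
    using F(3) that unfolding F_eq by blast+
  \<comment> \<open>Gluing needs this for every row index, while \<open>F\<close> bounds only the
    rows of its dots; each \<open>v\<close> is an entry of \<open>t\<close>, so every row carries
    such a dot.\<close>
  have "Y j < Y' v" if "v \<in> {Suc j..k}" for v
  proof -
    from that have "v \<in> set t" by (simp add: set_t)
    then obtain i where "i < length t" "t ! i = v" by (auto simp: in_set_conv_nth)
    with NE(2)[of "Suc j + i"] jk show ?thesis by auto
  qed
  then have Y'': "strict_mono_on {1..k} Y''"
    unfolding Y''_def[abs_def] by (rule strict_mono_on_glue[OF Y Y' j])
  have X'': "strict_mono_on {1..k} X''"
    unfolding X''_def[abs_def] using NE(1) by (rule strict_mono_on_glue[OF X X' j])
  have "(X'' i, Y'' ((a @ t) ! (i - 1))) \<in> P" if i: "i \<in> {1..k}" for i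
  proof (cases "i \<le> j")
    case True
    with i have i': "i \<in> {1..j}" by simp
    have "a ! (i - 1) \<le> j" using permutation_nth_mem[OF a i'] by simp
    with True i' dots[OF i'] show ?thesis by (auto simp: X''_def Y''_def nth_append len_a)
  next
    case False
    then have "t ! (i - Suc j) \<in> set t" using i jk by auto
    then have "j < t ! (i - Suc j)" using set_t by simp
    moreover have "(X' i, Y' (t ! (i - Suc j))) \<in> P" using F(2) False i unfolding F_eq by auto
    ultimately show ?thesis using False by (auto simp: X''_def Y''_def nth_append len_a)
  qed
  \<comment> \<open>For the empty suffix \<open>k\<close> equals \<open>j\<close>, and the corner is
    that of the prefix part.\<close>
  moreover have "(X'' k, Y'' k) \<in> B"
    using top top' jk by (cases "t = []") (auto simp: X''_def Y''_def)
  ultimately have "occurs B P (a @ t)"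
    unfolding occurs_def len using X'' Y'' by blast
  with tS show ?thesis by blast
qed

section \<open>Counting with a fixed marked region\<close>

lemma self_conjugate_iff: "self_conjugate l \<longleftrightarrow> (boxes l)\<inverse> = boxes l"
  unfolding self_conjugate_def by auto

text \<open>Only columns are mentioned: symmetry transfers the condition to rows when
  \<open>B\<close> is self-conjugate.\<close>

definition sym_full :: "(nat \<times> nat) set \<Rightarrow> (nat \<times> nat) set \<Rightarrow> bool" where
  "sym_full B P \<longleftrightarrow> P \<subseteq> B \<and> P\<inverse> = P \<and> (\<forall>x \<in> fst ` B. \<exists>!y. (x, y) \<in> P)"

lemma full_placement_symmetric_iff:
  assumes "self_conjugate l"
  shows "full_placement l P \<and> symmetric_placement P \<longleftrightarrow> sym_full (boxes l) P"
proof
  assume P: "full_placement l P \<and> symmetric_placement P"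
  then have "P\<inverse> = P" unfolding symmetric_placement_def by auto
  with P show "sym_full (boxes l) P"
    by (simp add: full_placement_def placement_def sym_full_def)
next
  assume full: "sym_full (boxes l) P"
  then have sym: "(x, y) \<in> P \<longleftrightarrow> (y, x) \<in> P" for x y unfolding sym_full_def by blast
  have sub: "P \<subseteq> boxes l" and row: "\<forall>x \<in> fst ` boxes l. \<exists>!y. (x, y) \<in> P"
    using full unfolding sym_full_def by auto
  have swap: "snd ` boxes l = fst ` boxes l"
    using assms unfolding self_conjugate_def by force
  have at_most: "\<exists>\<^sub>\<le>\<^sub>1 y. (x, y) \<in> P" for x
  proof (rule Uniq_I)
    fix y z assume "(x, y) \<in> P" "(x, z) \<in> P"
    moreover then have "x \<in> fst ` boxes l" using sub by force
    ultimately show "y = z" using row by blast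
  qed
  then have "\<exists>\<^sub>\<le>\<^sub>1 x. (x, y) \<in> P" for y using sym[of _ y] by simp
  with at_most row sub show "full_placement l P \<and> symmetric_placement P"
    unfolding full_placement_def placement_def symmetric_placement_def swap
    using sym by simp
qed

text \<open>Once the dots outside \<open>M\<close> are fixed, the remaining ones occupy a fixed set of rows and the
  same set of columns; deleting all other rows and columns turns \<open>M\<close> into a shape on which they
  form a full placement.\<close>

lemma ex_compressed_shape:
  assumes B: "finite B" "down_closed B"
    and M: "M \<subseteq> B" "down_closed M" "M\<inverse> = M"
    and P0: "sym_full B P0" and j: "1 \<le> j"
  obtains l where "is_shape l" "self_conjugate l"
    "\<And>a. a \<in> permutations_of_set {1..j} \<Longrightarrow>
       card {P. sym_full B P \<and> P - M = P0 - M \<and> \<not> occurs M P a} =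
       card {R. sym_full (boxes l) R \<and> \<not> occurs (boxes l) R a}"
proof -
  \<comment> \<open>The columns of the dots of \<open>P0\<close> inside \<open>M\<close>; by
    symmetry these are also their rows.\<close>
  define C where "C = fst ` (P0 \<inter> M)"
  define n where "n = card C"
  have symD: "(y, x) \<in> P" if "sym_full B P" "(x, y) \<in> P" for x y P
    using that unfolding sym_full_def by blast
  have uniq: "y = z" if "sym_full B P" "(x, y) \<in> P" "(x, z) \<in> P" for x y z P
  proof -
    have "x \<in> fst ` B" using that unfolding sym_full_def by force
    with that show ?thesis unfolding sym_full_def by blast
  qed
  have ex: "\<exists>y. (x, y) \<in> P" if "sym_full B P" "x \<in> fst ` B" for x P
    using that unfolding sym_full_def by blast
  have subB: "P \<subseteq> B" if "sym_full B P" for P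
    using that unfolding sym_full_def by blast
  have M_sym: "(y, x) \<in> M" if "(x, y) \<in> M" for x y using that M(3) by blast
  have fin_C: "finite C"
    unfolding C_def using B(1) M(1) by (meson finite_imageI finite_Int finite_subset)
  obtain h where h: "bij_betw h {..<n} C" "strict_mono_on {..<n} h"
    using ex_bij_betw_strict_mono_card[OF fin_C] unfolding n_def by blast
  \<comment> \<open>The increasing enumeration of \<open>C\<close>, shifted to start at 1.\<close>
  define d where "d i = h (i - 1)" for i
  have d_mono: "strict_mono_on {1..n} d"
    using h(2) by (auto simp: d_def intro!: strict_mono_onI strict_mono_onD[of "{..<n}" h])
  have d_inj: "inj_on d {1..n}" using d_mono by (rule strict_mono_on_imp_inj_on)
  have d_im: "d ` {1..n} = C"
  proof -
    have "{..<n} = (\<lambda>i. i - 1) ` {1..n}"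
      by (force simp: image_iff intro: bexI[of _ "Suc _"])
    then show ?thesis using h(1) unfolding bij_betw_def d_def by (simp add: image_image)
  qed
  \<comment> \<open>Otherwise the dot of \<open>P0\<close> in column \<open>x\<close> lies outside
    \<open>M\<close>, hence is shared by \<open>P\<close>, which would have a second dot in that
    column.\<close>
  have C_col: "x \<in> C" if P: "sym_full B P" "P - M = P0 - M" "(x, y) \<in> P" "(x, y) \<in> M" for P x y
  proof (rule ccontr)
    assume "x \<notin> C"
    have "x \<in> fst ` B" using P subB by force
    then obtain y0 where y0: "(x, y0) \<in> P0" using ex P0 by blast
    with \<open>x \<notin> C\<close> have "(x, y0) \<notin> M" by (force simp: C_def)
    with y0 P(2) have "(x, y0) \<in> P" by blast
    with uniq P(1,3) have "y = y0" by blast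
    with \<open>(x, y0) \<notin> M\<close> P(4) show False by simp
  qed
  have C_row: "y \<in> C" if "sym_full B P" "P - M = P0 - M" "(x, y) \<in> P" "(x, y) \<in> M" for P x y
    using C_col[OF that(1,2)] symD[OF that(1,3)] M_sym[OF that(4)] by blast
  define B' where "B' = {(x, y). x \<in> {1..n} \<and> y \<in> {1..n} \<and> (d x, d y) \<in> M}"
  have "finite B'"
    by (rule finite_subset[of _ "{1..n} \<times> {1..n}"]) (auto simp: B'_def)
  moreover have "down_closed B'"
    unfolding down_closed_def
  proof (intro ballI, clarify)
    fix x y assume xy: "(x, y) \<in> B'"
    have "(x', y') \<in> B'" if "1 \<le> x'" "x' \<le> x" "1 \<le> y'" "y' \<le> y" for x' y'
    proof -
      have range: "x' \<in> {1..n}" "y' \<in> {1..n}" "x \<in> {1..n}" "y \<in> {1..n}"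
        using that xy by (auto simp: B'_def)
      have "d x' \<in> C" "d y' \<in> C" using range d_im by blast+
      then have "1 \<le> d x'" "1 \<le> d y'"
        unfolding C_def using down_closed_pos[OF M(2)] by force+
      moreover have "d x' \<le> d x" "d y' \<le> d y" using range that by (auto intro!: mono_on_le[OF d_mono])
      moreover have "(d x, d y) \<in> M" using xy by (simp add: B'_def)
      ultimately have "(d x', d y') \<in> M" using down_closedD[OF M(2)] by blast
      then show ?thesis using range by (simp add: B'_def)
    qed
    then show "1 \<le> x \<and> 1 \<le> y \<and> (\<forall>x' y'. 1 \<le> x' \<and> x' \<le> x \<and> 1 \<le> y' \<and> y' \<le> y \<longrightarrow> (x', y') \<in> B')"
      using xy by (auto simp: B'_def)
  qed
  ultimately obtain l where l: "is_shape l" "boxes l = B'" using ex_shape_boxes by blast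
  have B'_sym: "(y, x) \<in> B'" if "(x, y) \<in> B'" for x y using that M_sym by (auto simp: B'_def)
  then have "self_conjugate l" unfolding self_conjugate_def l(2) by blast
  \<comment> \<open>No column is lost in the compression, so a full placement on \<open>B'\<close>
    has a dot in each of the \<open>n\<close> columns.\<close>
  have fst_B': "fst ` B' = {1..n}"
  proof
    show "{1..n} \<subseteq> fst ` B'"
    proof
      fix x assume x: "x \<in> {1..n}"
      then have "d x \<in> C" using d_im by blast
      then obtain y where y: "(d x, y) \<in> P0" "(d x, y) \<in> M" by (auto simp: C_def)
      then have "y \<in> C" using C_row P0 by blast
      then obtain y' where "y' \<in> {1..n}" "y = d y'" using d_im by blast
      with x y have "(x, y') \<in> B'" by (simp add: B'_def)
      then show "x \<in> fst ` B'" by force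
    qed
  qed (auto simp: B'_def)
  \<comment> \<open>\<open>f\<close> and \<open>g\<close> will be mutually inverse: \<open>g\<close>
    compresses the dots inside \<open>M\<close>, and \<open>f\<close> expands them and restores the
    fixed dots outside.\<close>
  define f where "f R = (P0 - M) \<union> map_prod d d ` R" for R
  define g where "g P = {(x, y). x \<in> {1..n} \<and> y \<in> {1..n} \<and> (d x, d y) \<in> P \<inter> M}" for P
  have gf: "g (f R) = R" if "R \<subseteq> B'" for R
  proof -
    have "(x, y) \<in> R" if "x \<in> {1..n}" "y \<in> {1..n}" "(d x, d y) \<in> map_prod d d ` R" for x y
    proof -
      from that(3) obtain x' y' where xy': "(x', y') \<in> R" "d x = d x'" "d y = d y'" by auto
      moreover have "x' \<in> {1..n}" "y' \<in> {1..n}" using xy' \<open>R \<subseteq> B'\<close> by (auto simp: B'_def)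
      ultimately show ?thesis using that(1,2) d_inj by (metis inj_onD)
    qed
    then show ?thesis using that by (fastforce simp: g_def f_def B'_def)
  qed
  have fg: "f (g P) = P" if P: "sym_full B P" "P - M = P0 - M" for P
  proof -
    have "map_prod d d ` g P = P \<inter> M"
    proof
      show "P \<inter> M \<subseteq> map_prod d d ` g P"
      proof clarify
        fix x y assume xy: "(x, y) \<in> P" "(x, y) \<in> M"
        then have "x \<in> d ` {1..n}" "y \<in> d ` {1..n}" using C_col[OF P] C_row[OF P] d_im by auto
        then obtain x' y' where "x' \<in> {1..n}" "y' \<in> {1..n}" "x = d x'" "y = d y'" by blast
        with xy show "(x, y) \<in> map_prod d d ` g P" by (force simp: g_def)
      qed
    qed (auto simp: g_def)
    then show ?thesis using P(2) unfolding f_def by blast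
  qed
  have f_minus: "f R - M = P0 - M" if "R \<subseteq> B'" for R
    using that by (auto simp: f_def B'_def)
  have g_full: "sym_full B' (g P)" if P: "sym_full B P" "P - M = P0 - M" for P
    unfolding sym_full_def
  proof (intro conjI ballI)
    show "g P \<subseteq> B'" by (auto simp: g_def B'_def)
    show "(g P)\<inverse> = g P" using symD[OF P(1)] M_sym by (auto simp: g_def)
    fix x assume "x \<in> fst ` B'"
    then have x: "x \<in> {1..n}" using fst_B' by simp
    then have "d x \<in> C" using d_im by blast
    then obtain y0 where y0: "(d x, y0) \<in> P0" "(d x, y0) \<in> M" by (auto simp: C_def)
    then have "d x \<in> fst ` B" using subB[OF P0] by force
    then obtain y where y: "(d x, y) \<in> P" using ex P(1) by blast
    \<comment> \<open>An outside dot would be shared with \<open>P0\<close>, whose only dot in this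
      column lies in \<open>M\<close>.\<close>
    have yM: "(d x, y) \<in> M"
    proof (rule ccontr)
      assume "(d x, y) \<notin> M"
      with y P(2) have "(d x, y) \<in> P0" by blast
      with uniq[OF P0 y0(1)] y0(2) \<open>(d x, y) \<notin> M\<close> show False by blast
    qed
    from C_row[OF P y yM] obtain y' where y': "y' \<in> {1..n}" "y = d y'" using d_im by blast
    show "\<exists>!z. (x, z) \<in> g P"
    proof
      show "(x, y') \<in> g P" using x y yM y' by (simp add: g_def)
      fix z assume "(x, z) \<in> g P"
      then have z: "z \<in> {1..n}" "(d x, d z) \<in> P" by (auto simp: g_def)
      then have "d z = d y'" using uniq[OF P(1) y] y' by simp
      then show "z = y'" using z(1) y'(1) d_inj by (meson inj_onD)
    qed
  qed
  have f_full: "sym_full B (f R)" if R: "sym_full B' R" for R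
    unfolding sym_full_def
  proof (intro conjI ballI)
    have RB: "R \<subseteq> B'" and R_sym: "\<And>x y. (x, y) \<in> R \<Longrightarrow> (y, x) \<in> R"
      using R unfolding sym_full_def by blast+
    have R_row: "\<forall>x \<in> {1..n}. \<exists>!y. (x, y) \<in> R"
      using R by (simp add: sym_full_def fst_B')
    have Q_M: "map_prod d d ` R \<subseteq> M" using RB by (auto simp: B'_def)
    then show "f R \<subseteq> B" using subB[OF P0] M(1) by (auto simp: f_def)
    have f_sym: "(y, x) \<in> f R" if "(x, y) \<in> f R" for x y
      using that symD[OF P0] M_sym R_sym by (force simp: f_def)
    then show "(f R)\<inverse> = f R" by auto
    fix x assume x: "x \<in> fst ` B"
    then obtain y0 where y0: "(x, y0) \<in> P0" using ex P0 by blast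
    show "\<exists>!y. (x, y) \<in> f R"
    proof (cases "x \<in> C")
      case True
      then have y0M: "(x, y0) \<in> M" using uniq[OF P0 y0] by (auto simp: C_def)
      from True obtain x' where x': "x' \<in> {1..n}" "x = d x'" using d_im by blast
      then obtain y' where y': "(x', y') \<in> R" "\<And>z. (x', z) \<in> R \<Longrightarrow> z = y'"
        using R_row by blast
      show ?thesis
      proof
        show "(x, d y') \<in> f R" using x'(2) y'(1) by (auto simp: f_def intro: map_prod_imageI)
        fix z assume "(x, z) \<in> f R"
        moreover have "(x, z) \<notin> P0 - M" using uniq[OF P0 y0] y0M by blast
        ultimately obtain u v where uv: "(u, v) \<in> R" "x = d u" "z = d v" by (auto simp: f_def)
        then have "u \<in> {1..n}" using RB by (auto simp: B'_def)
        then have "u = x'" using uv x' d_inj by (metis inj_onD)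
        then show "z = d y'" using uv y'(2) by simp
      qed
    next
      case False
      then have "(x, y0) \<notin> M" using y0 by (force simp: C_def)
      show ?thesis
      proof
        show "(x, y0) \<in> f R" using y0 \<open>(x, y0) \<notin> M\<close> by (simp add: f_def)
        fix z assume "(x, z) \<in> f R"
        moreover have "(x, z) \<notin> map_prod d d ` R"
          using False RB d_im by (auto simp: B'_def)
        ultimately show "z = y0" using uniq[OF P0 y0] by (auto simp: f_def)
      qed
    qed
  qed
  have occ: "occurs M P a \<longleftrightarrow> occurs B' (g P) a"
    if a: "a \<in> permutations_of_set {1..j}" and P: "sym_full B P" "P - M = P0 - M" for P a
  proof -
    have len: "length a = j" using a length_finite_permutations_of_set by fastforce
    show ?thesis
    proof
      assume "occurs M P a"
      then obtain X Y where X: "strict_mono_on {1..j} X" and Y: "strict_mono_on {1..j} Y"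
        and dots: "\<And>i. i \<in> {1..j} \<Longrightarrow> (X i, Y (a ! (i - 1))) \<in> P" and top: "(X j, Y j) \<in> M"
        unfolding occurs_def len by blast
      \<comment> \<open>With its corner in the down-closed \<open>M\<close>, an occurrence uses only
        dots of \<open>M\<close>, all of which survive the compression.\<close>
      have dots_M: "(X i, Y (a ! (i - 1))) \<in> M" if i: "i \<in> {1..j}" for i
      proof (rule down_closedD[OF M(2) top])
        have v: "a ! (i - 1) \<in> {1..j}" by (rule permutation_nth_mem[OF a i])
        show "X i \<le> X j" "Y (a ! (i - 1)) \<le> Y j"
          using i v by (auto intro!: mono_on_le[OF X] mono_on_le[OF Y])
        have "(X i, Y (a ! (i - 1))) \<in> B" using dots[OF i] subB[OF P(1)] by blast
        then show "1 \<le> X i" "1 \<le> Y (a ! (i - 1))" using down_closed_pos[OF B(2)] by blast+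
      qed
      define e where "e = inv_into {1..n} d"
      have e: "e x \<in> {1..n}" "d (e x) = x" if "x \<in> C" for x
        using that unfolding d_im[symmetric] e_def by (meson inv_into_into f_inv_into_f)+
      have XC: "X i \<in> C" if "i \<in> {1..j}" for i
        using C_col[OF P dots[OF that] dots_M[OF that]] .
      have YC: "Y v \<in> C" if v: "v \<in> {1..j}" for v
      proof -
        obtain i where i: "i \<in> {1..j}" "a ! (i - 1) = v" using permutation_nth_surj[OF a v] .
        then show ?thesis using C_row[OF P dots[OF i(1)] dots_M[OF i(1)]] by simp
      qed
      have e_mono: "e x < e y" if "x \<in> C" "y \<in> C" "x < y" for x y
        using e[OF that(1)] e[OF that(2)] that(3) mono_on_le[OF d_mono] by (metis not_le)
      have "strict_mono_on {1..j} (e \<circ> X)" "strict_mono_on {1..j} (e \<circ> Y)"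
        using X Y XC YC e_mono by (auto simp: strict_mono_on_def)
      moreover have "((e \<circ> X) i, (e \<circ> Y) (a ! (i - 1))) \<in> g P" if i: "i \<in> {1..j}" for i
        using e[OF XC[OF i]] e[OF YC[OF permutation_nth_mem[OF a i]]] dots[OF i] dots_M[OF i]
        by (simp add: g_def)
      moreover have "((e \<circ> X) j, (e \<circ> Y) j) \<in> B'"
        using e[OF XC[of j]] e[OF YC[of j]] top j by (simp add: B'_def)
      ultimately show "occurs B' (g P) a" unfolding occurs_def len by blast
    next
      assume "occurs B' (g P) a"
      then obtain X Y where X: "strict_mono_on {1..j} X" and Y: "strict_mono_on {1..j} Y"
        and dots: "\<And>i. i \<in> {1..j} \<Longrightarrow> (X i, Y (a ! (i - 1))) \<in> g P" and top: "(X j, Y j) \<in> B'"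
        unfolding occurs_def len by blast
      have X_range: "X i \<in> {1..n}" if "i \<in> {1..j}" for i
        using dots[OF that] by (simp add: g_def)
      have Y_range: "Y v \<in> {1..n}" if v: "v \<in> {1..j}" for v
      proof -
        obtain i where "i \<in> {1..j}" "a ! (i - 1) = v" using permutation_nth_surj[OF a v] .
        with dots[of i] show ?thesis by (simp add: g_def)
      qed
      have "strict_mono_on {1..j} (d \<circ> X)" "strict_mono_on {1..j} (d \<circ> Y)"
        using X Y X_range Y_range d_mono by (simp_all add: strict_mono_on_def)
      moreover have "((d \<circ> X) i, (d \<circ> Y) (a ! (i - 1))) \<in> P" if "i \<in> {1..j}" for i
        using dots[OF that] by (simp add: g_def)
      moreover have "((d \<circ> X) j, (d \<circ> Y) j) \<in> M" using top by (simp add: B'_def)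
      ultimately show "occurs M P a" unfolding occurs_def len by blast
    qed
  qed
  have "card {P. sym_full B P \<and> P - M = P0 - M \<and> \<not> occurs M P a} =
      card {R. sym_full B' R \<and> \<not> occurs B' R a}" if a: "a \<in> permutations_of_set {1..j}" for a
  proof (rule bij_betw_same_card[OF bij_betw_byWitness[of _ f g]])
    show "\<forall>P \<in> {P. sym_full B P \<and> P - M = P0 - M \<and> \<not> occurs M P a}. f (g P) = P"
      using fg by blast
    show "\<forall>R \<in> {R. sym_full B' R \<and> \<not> occurs B' R a}. g (f R) = R"
      using gf unfolding sym_full_def by blast
    show "g ` {P. sym_full B P \<and> P - M = P0 - M \<and> \<not> occurs M P a}
        \<subseteq> {R. sym_full B' R \<and> \<not> occurs B' R a}"
      using g_full occ[OF a] by blast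
    show "f ` {R. sym_full B' R \<and> \<not> occurs B' R a}
        \<subseteq> {P. sym_full B P \<and> P - M = P0 - M \<and> \<not> occurs M P a}"
    proof clarify
      fix R assume R: "sym_full B' R" "\<not> occurs B' R a"
      then have RB: "R \<subseteq> B'" by (simp add: sym_full_def)
      show "sym_full B (f R) \<and> f R - M = P0 - M \<and> \<not> occurs M (f R) a"
        using f_full[OF R(1)] f_minus[OF RB] occ[OF a] gf[OF RB] R(2) by simp
    qed
  qed
  then show thesis by (rule that[OF l(1) \<open>self_conjugate l\<close>, unfolded l(2)])
qed

section \<open>Summation over all marked regions\<close>

text \<open>Lets two counts be compared through one representative of each fibre. The map \<phi>
  will record the marked region together with the dots outside it.\<close>

lemma card_eq_fibrewise:
  assumes "finite U" "A \<subseteq> U" "A' \<subseteq> U"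
    and "\<And>u. u \<in> U \<Longrightarrow> card {x \<in> A. \<phi> x = \<phi> u} = card {x \<in> A'. \<phi> x = \<phi> u}"
  shows "card A = card A'"
proof -
  have *: "card D = (\<Sum>k \<in> \<phi> ` U. card {x \<in> D. \<phi> x = k})" if "D \<subseteq> U" for D
  proof -
    have "D = (\<Union>k \<in> \<phi> ` U. {x \<in> D. \<phi> x = k})" using that by blast
    then have "card D = card (\<Union>k \<in> \<phi> ` U. {x \<in> D. \<phi> x = k})" by simp
    also have "\<dots> = (\<Sum>k \<in> \<phi> ` U. card {x \<in> D. \<phi> x = k})"
      using assms(1) that by (intro card_UN_disjoint) (auto intro: finite_subset)
    finally show ?thesis .
  qed
  show ?thesis
    unfolding *[OF assms(2)] *[OF assms(3)] using assms(4) by (auto intro: sum.cong)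
qed

text \<open>Avoiding the whole set becomes avoiding the single prefix inside a region. That region
  is built from \<open>j\<close> and the suffixes \<open>S\<close> and does not involve
  \<open>a\<close>, so different prefixes can be compared.\<close>

lemma sym_count_append:
  assumes l: "is_shape l" "self_conjugate l"
    and a: "a \<in> permutations_of_set {1..j}" "1 \<le> j" "is_involution a"
    and S: "\<And>t. t \<in> S \<Longrightarrow> \<exists>k\<ge>j. t \<in> permutations_of_set {j + 1..k}"
  shows "sym_count l ((@) a ` S) = card {P. sym_full (boxes l) P \<and>
     \<not> occurs (marked (boxes l) (sym_suffix_configs (boxes l) j S) P) P a}"
proof -
  have conv: "(boxes l)\<inverse> = boxes l" using l(2) by (simp add: self_conjugate_iff)
  have len: "length a = j" using a(1) length_finite_permutations_of_set by fastforce
  have contains: "contains_pattern l P (a @ t) \<longleftrightarrow> occurs (boxes l) P (a @ t)" if t: "t \<in> S" for t P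
  proof -
    obtain k where k: "j \<le> k" "t \<in> permutations_of_set {j + 1..k}" using S[OF t] by blast
    then have "a @ t \<in> permutations_of_set {1..k}"
      using a(1) by (auto simp: permutations_of_set_def)
    then show ?thesis by (rule contains_pattern_iff_occurs) (use a(2) k(1) in simp)
  qed
  have "(\<forall>s \<in> (@) a ` S. \<not> contains_pattern l P s) \<longleftrightarrow>
      \<not> occurs (marked (boxes l) (sym_suffix_configs (boxes l) j S) P) P a"
    if P: "sym_full (boxes l) P" for P
  proof -
    have "P \<subseteq> boxes l" "P\<inverse> = P" using P by (auto simp: sym_full_def)
    then have "(\<exists>t \<in> S. occurs (boxes l) P (a @ t)) \<longleftrightarrow>
        occurs (marked (boxes l) (sym_suffix_configs (boxes l) j S) P) P a"
      using occurs_append_imp_occurs_marked[OF a(1,2) _ _ _ down_closed_boxes[OF l(1)]]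
        occurs_marked_imp_occurs_append[OF a S conv] S by meson
    moreover have "(\<forall>s \<in> (@) a ` S. \<not> contains_pattern l P s) \<longleftrightarrow>
        \<not> (\<exists>t \<in> S. occurs (boxes l) P (a @ t))"
      using contains by simp
    ultimately show ?thesis by (simp only:)
  qed
  then show ?thesis
    unfolding sym_count_def conj_assoc[symmetric] full_placement_symmetric_iff[OF l(2)]
    by (intro arg_cong[where f = card] Collect_cong conj_cong refl)
qed

theorem theorem3p1:
  fixes j :: nat and \<alpha> \<beta> :: "nat list" and T\<^sub>\<alpha> T\<^sub>\<beta> :: "nat list set"
  assumes "j \<ge> 1"
    and "\<alpha> \<in> permutations_of_set {1..j}" and "is_involution \<alpha>"
    and "\<beta> \<in> permutations_of_set {1..j}" and "is_involution \<beta>"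
    and "\<forall>\<sigma>\<in>T\<^sub>\<alpha>. begins_with_prefix \<alpha> \<sigma>"
    and "T\<^sub>\<beta> = replace_prefix \<alpha> \<beta> ` T\<^sub>\<alpha>"
    and "\<forall>l. is_shape l \<and> self_conjugate l \<longrightarrow> sym_count l {\<alpha>} = sym_count l {\<beta>}"
  shows "\<forall>m. is_shape m \<and> self_conjugate m \<longrightarrow> sym_count m T\<^sub>\<alpha> = sym_count m T\<^sub>\<beta>"
proof (intro allI impI)
  fix m assume m: "is_shape m \<and> self_conjugate m"
  \<comment> \<open>Both pattern sets arise from this one set of suffixes, so the map
    \<open>mk\<close> below serves \<alpha> and \<beta> alike.\<close>
  define S where "S = {t. \<alpha> @ t \<in> T\<^sub>\<alpha>}"
  have len: "length \<alpha> = j" using assms(2) length_finite_permutations_of_set by fastforce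
  have S: "\<exists>k\<ge>j. t \<in> permutations_of_set {j + 1..k}" if "t \<in> S" for t
  proof -
    have "begins_with_prefix \<alpha> (\<alpha> @ t)" using that assms(6) by (simp add: S_def)
    then show ?thesis by (auto simp: begins_with_prefix_def len)
  qed
  have T\<^sub>\<alpha>: "T\<^sub>\<alpha> = (@) \<alpha> ` S"
    using assms(6) by (force simp: S_def begins_with_prefix_def)
  then have T\<^sub>\<beta>: "T\<^sub>\<beta> = (@) \<beta> ` S"
    unfolding assms(7) by (simp add: image_image)
  define B where "B = boxes m"
  define mk where "mk = marked B (sym_suffix_configs B j S)"
  have B: "finite B" "down_closed B" "B\<inverse> = B"
    using m down_closed_boxes by (simp_all add: B_def finite_boxes self_conjugate_iff)
  define avoiders where "avoiders a = {P. sym_full B P \<and> \<not> occurs (mk P) P a}" for a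
  have count: "sym_count l {a} = card {R. sym_full (boxes l) R \<and> \<not> occurs (boxes l) R a}"
    if "is_shape l" "self_conjugate l" "a \<in> permutations_of_set {1..j}" for l a
    unfolding sym_count_def conj_assoc[symmetric] full_placement_symmetric_iff[OF that(2)]
    using contains_pattern_iff_occurs[OF that(3) assms(1)] by simp
  have "card (avoiders \<alpha>) = card (avoiders \<beta>)"
  proof (rule card_eq_fibrewise[where \<phi> = "\<lambda>P. (mk P, P - mk P)"])
    show "finite {P. sym_full B P}"
      by (rule finite_subset[of _ "Pow B"]) (auto simp: sym_full_def B(1))
    fix P0 assume "P0 \<in> {P. sym_full B P}"
    then have P0: "sym_full B P0" by simp
    define M where "M = mk P0"
    have M: "M \<subseteq> B" "down_closed M" "M\<inverse> = M"
      unfolding M_def mk_def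
      using P0 by (simp_all add: marked_subset down_closed_marked[OF B(2)] sym_full_def
          converse_marked[OF B(3) converse_sym_suffix_configs])
    have "mk (P0 - M) = M"
      unfolding M_def mk_def by (rule marked_remove_marked[OF B(1,2)])
    \<comment> \<open>Agreement with \<open>P0\<close> outside \<open>M\<close> alone forces the
      same marked region, so the fibre is described by the outside dots.\<close>
    then have mk_eq: "mk P = M" if "P - M = P0 - M" for P
      using that marked_eqI[OF B(1,2)] unfolding mk_def by metis
    have fibre: "{P \<in> avoiders a. (mk P, P - mk P) = (mk P0, P0 - mk P0)} =
        {P. sym_full B P \<and> P - M = P0 - M \<and> \<not> occurs M P a}" for a
      using mk_eq unfolding avoiders_def M_def[symmetric] by auto
    \<comment> \<open>The shape is obtained before the pattern is chosen, so both fibre counts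
      reduce to the same \<open>l\<close>, where the hypothesis applies.\<close>
    obtain l where l: "is_shape l" "self_conjugate l"
      "\<And>a. a \<in> permutations_of_set {1..j} \<Longrightarrow>
         card {P. sym_full B P \<and> P - M = P0 - M \<and> \<not> occurs M P a} =
         card {R. sym_full (boxes l) R \<and> \<not> occurs (boxes l) R a}"
      by (rule ex_compressed_shape[OF B(1,2) M P0 assms(1)]) (rule that)
    show "card {P \<in> avoiders \<alpha>. (mk P, P - mk P) = (mk P0, P0 - mk P0)} =
        card {P \<in> avoiders \<beta>. (mk P, P - mk P) = (mk P0, P0 - mk P0)}"
      unfolding fibre l(3)[OF assms(2)] l(3)[OF assms(4)]
        count[OF l(1,2) assms(2), symmetric] count[OF l(1,2) assms(4), symmetric]
      using assms(8) l(1,2) by blast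
  qed (auto simp: avoiders_def)
  then show "sym_count m T\<^sub>\<alpha> = sym_count m T\<^sub>\<beta>"
    unfolding T\<^sub>\<alpha> T\<^sub>\<beta> avoiders_def mk_def B_def
    using sym_count_append[OF _ _ assms(2,1,3) S] sym_count_append[OF _ _ assms(4,1,5) S] m
    by simp
qed

end
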